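(* Let $M\in\mathbb R^{m\times n}$ be a matrix of rank $r$, where $r\le n\le m$. (i) If $R\in\mathbb R^{m\times r}$ satisfies $\mathcal R(R)=\mathcal R(M)$ and $U(R)$ is a matrix obtained from $R$ by column orthogonalization, then a rank-$r$ representation of $M$ is given by $$M=R(R^TR)^{-1}R^TM=U(R)U(R)^TM .$$ (ii) If $B$ is an $n\times r$ Gaussian matrix and $R=MB$, then $\mathcal R(R)=\mathcal R(M)$ with probability $1$. (iii) If $B$ is an $n\times r$ matrix whose entries are i.i.d. random variables sampled uniformly from a finite set $\mathcal S$ of cardinality $|\mathcal S|$, and $R=MB$, then $\mathcal R(R)=\mathcal R(M)$ with probability at least $1-r/|\mathcal S|$.
   Context: $\mathcal R(W)$ denotes the range (column span) of a matrix $W$. A matrix is Gaussian if all its entries are i.i.d. standard normal random variables. A matrix $U(R)$ obtained from $R$ by column orthogonalization is a matrix with orthonormal columns whose column span equals $\mathcal R(R)$. The matrices are real and the finite set $\mathcal S$ consists of real numbers. *)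

theory Defs
  imports
    "HOL-Probability.Probability"
    "Jordan_Normal_Form.DL_Rank"
    "Jordan_Normal_Form.Gauss_Jordan_Elimination"
begin

text \<open>Matrices carry their dimensions as natural numbers, so that the degenerate case \<open>r = 0\<close>
  (matrices without columns) is covered as well.\<close>

(* 'vec', 'mat', 'col' etc. exist in HOL-Analysis, too; the import order makes the unqualified
   names refer to Jordan_Normal_Form. *)

definition mat_range :: "real mat \<Rightarrow> real vec set" where
  "mat_range W = vec_space.col_space (dim_row W) W"

definition orthonormal_cols :: "real mat \<Rightarrow> bool" where
  "orthonormal_cols U \<longleftrightarrow>
     (\<forall>i < dim_col U. \<forall>j < dim_col U.
        scalar_prod (col U i) (col U j) = (if i = j then 1 else 0))"

text \<open>No particular algorithm is fixed, and the number of columns of \<open>U\<close> is not prescribed: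
  it is forced to be the rank of \<open>R\<close>.\<close>

definition column_orthogonalization :: "real mat \<Rightarrow> real mat \<Rightarrow> bool" where
  "column_orthogonalization R U \<longleftrightarrow>
     dim_row U = dim_row R \<and> orthonormal_cols U \<and> mat_range U = mat_range R"

definition rank_representation :: "nat \<Rightarrow> real mat \<Rightarrow> real mat \<Rightarrow> real mat \<Rightarrow> bool" where
  "rank_representation r M X Y \<longleftrightarrow>
     X \<in> carrier_mat (dim_row M) r \<and> Y \<in> carrier_mat r (dim_col M) \<and> M = X * Y"

text \<open>\<open>iid_mat P D n r B\<close>: on the probability space \<open>P\<close>, \<open>B\<close> is a random \<open>n \<times> r\<close> matrix whose
  entries are independent and all have law \<open>D\<close>. Measurability of the entries is part of
  \<open>indep_vars\<close>.\<close>

definition iid_mat ::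
  "'w measure \<Rightarrow> real measure \<Rightarrow> nat \<Rightarrow> nat \<Rightarrow> ('w \<Rightarrow> real mat) \<Rightarrow> bool" where
  "iid_mat P D n r B \<longleftrightarrow>
     (\<forall>\<omega> \<in> space P. B \<omega> \<in> carrier_mat n r) \<and>
     prob_space.indep_vars P (\<lambda>_. borel) (\<lambda>(i, j) \<omega>. B \<omega> $$ (i, j)) ({..<n} \<times> {..<r}) \<and>
     (\<forall>i < n. \<forall>j < r. distr P borel (\<lambda>\<omega>. B \<omega> $$ (i, j)) = D)"

definition gaussian_mat :: "'w measure \<Rightarrow> nat \<Rightarrow> nat \<Rightarrow> ('w \<Rightarrow> real mat) \<Rightarrow> bool" where
  "gaussian_mat P n r B \<longleftrightarrow> iid_mat P std_normal_distribution n r B"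

text \<open>The uniform measure on \<open>S\<close> lives on the discrete sigma-algebra of \<open>S\<close>; it is pushed forward
  to a Borel measure on the reals.\<close>

definition uniform_mat ::
  "'w measure \<Rightarrow> real set \<Rightarrow> nat \<Rightarrow> nat \<Rightarrow> ('w \<Rightarrow> real mat) \<Rightarrow> bool" where
  "uniform_mat P S n r B \<longleftrightarrow> iid_mat P (distr (uniform_count_measure S) borel (\<lambda>x. x)) n r B"

end

theory Submission
  imports Defs
begin

text \<open>Factor \<open>M = C * D\<close> where the \<open>r\<close> columns of \<open>C\<close> form a basis of the range of \<open>M\<close>. For part (i), a
  matrix \<open>R\<close> with the range of \<open>M\<close> has a trivial kernel, so its Gram matrix is invertible; writing
  \<open>M = R * Z\<close> makes both projection formulas immediate. For parts (ii) and (iii), \<open>M * B\<close> has the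
  range of \<open>M\<close> iff \<open>det (D * B) \<noteq> 0\<close>. This determinant is affine in each entry of \<open>B\<close>, of total degree
  \<open>r\<close>, and not identically zero since \<open>D\<close> has a right inverse. Hence if no value has probability more
  than \<open>p\<close>, a Schwartz--Zippel argument bounds the probability of a zero by \<open>r * p\<close>; here \<open>p = 0\<close> for
  Gaussian entries and \<open>p = 1 / card S\<close> for uniform ones.\<close>

section \<open>Ranges of matrices and factorizations through a matrix\<close>

lemma mat_range_conv:
  assumes "A \<in> carrier_mat m k"
  shows "mat_range A = (\<lambda>x. A *\<^sub>v x) ` carrier_vec k"
  using assms vec_space.col_space_eq[of A m k] by (auto simp: mat_range_def)

text \<open>Column \<open>j\<close> of \<open>X\<close> holds coefficients that express column
  \<open>j\<close> of \<open>A\<close> through the columns of \<open>B\<close>. This turns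
  inclusions of ranges into matrix equations.\<close>

lemma mat_range_subset_iff:
  assumes A: "A \<in> carrier_mat m k" and B: "B \<in> carrier_mat m l"
  shows "mat_range A \<subseteq> mat_range B \<longleftrightarrow> (\<exists>X \<in> carrier_mat l k. A = B * X)"
proof
  assume sub: "mat_range A \<subseteq> mat_range B"
  have "\<exists>x \<in> carrier_vec l. col A j = B *\<^sub>v x" if j: "j < k" for j
  proof -
    have "col A j = A *\<^sub>v unit_vec k j"
      using A j by (intro eq_vecI) auto
    also have "\<dots> \<in> mat_range B"
      using sub A by (auto simp: mat_range_conv)
    finally show ?thesis using B by (auto simp: mat_range_conv)
  qed
  then obtain x where x: "\<And>j. j < k \<Longrightarrow> x j \<in> carrier_vec l \<and> col A j = B *\<^sub>v x j"
    by metis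
  define X where "X = mat_of_cols l (map x [0..<k])"
  have X: "X \<in> carrier_mat l k" by (auto simp: X_def)
  have "A = B * X"
  proof (rule mat_col_eqI)
    fix j assume "j < dim_col (B * X)"
    then have j: "j < k" using X by simp
    have "col X j = x j" using j x by (auto simp: X_def)
    then show "col A j = col (B * X) j"
      using x[OF j] by (simp only: col_mult2[OF B X j])
  qed (use A B X in auto)
  then show "\<exists>X \<in> carrier_mat l k. A = B * X" using X by blast
next
  assume "\<exists>X \<in> carrier_mat l k. A = B * X"
  then obtain X where X: "X \<in> carrier_mat l k" "A = B * X" by blast
  show "mat_range A \<subseteq> mat_range B"
  proof
    fix y assume "y \<in> mat_range A"
    then obtain x where x: "x \<in> carrier_vec k" "y = A *\<^sub>v x"
      using A by (auto simp: mat_range_conv)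
    then have "y = B *\<^sub>v (X *\<^sub>v x)" using X B by simp
    then show "y \<in> mat_range B" using X x B by (auto simp: mat_range_conv)
  qed
qed

corollary mat_range_mult_subset:
  assumes "A \<in> carrier_mat m l" "X \<in> carrier_mat l k"
  shows "mat_range (A * X) \<subseteq> mat_range A"
  using mat_range_subset_iff[of "A * X" m k A l] assms by auto

section \<open>Matrices with trivial kernel\<close>

text \<open>Independence of the columns as a family: unlike independence of the set of columns, a
  trivial kernel also excludes repeated columns.\<close>

definition injective_mat :: "real mat \<Rightarrow> bool" where
  "injective_mat A \<longleftrightarrow> (\<forall>v \<in> carrier_vec (dim_col A). A *\<^sub>v v = 0\<^sub>v (dim_row A) \<longrightarrow> v = 0\<^sub>v (dim_col A))"

text \<open>By linearity, each difference of corresponding columns of \<open>X\<close> and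
  \<open>Y\<close> lies in the kernel of \<open>C\<close>.\<close>

lemma injective_mat_cancel:
  assumes "injective_mat C" and C: "C \<in> carrier_mat m r" and X: "X \<in> carrier_mat r k" and Y: "Y \<in> carrier_mat r k"
    and eq: "C * X = C * Y"
  shows "X = Y"
proof (rule mat_col_eqI)
  fix j assume "j < dim_col Y"
  then have j: "j < k" using Y by simp
  have "C *\<^sub>v (col X j - col Y j) = C *\<^sub>v col X j - C *\<^sub>v col Y j"
    using C X Y by (intro mult_minus_distrib_mat_vec) auto
  also have "C *\<^sub>v col X j = C *\<^sub>v col Y j"
    using arg_cong[OF eq, of "\<lambda>Z. col Z j"] C X Y j by (simp only: col_mult2[OF C X j] col_mult2[OF C Y j])
  also have "C *\<^sub>v col Y j - C *\<^sub>v col Y j = 0\<^sub>v m"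
    using C Y by auto
  finally have "C *\<^sub>v (col X j - col Y j) = 0\<^sub>v m" .
  moreover have "col X j - col Y j \<in> carrier_vec r" using X Y j by auto
  ultimately have "col X j - col Y j = 0\<^sub>v r"
    using assms(1) C by (auto simp: injective_mat_def)
  then show "col X j = col Y j"
    using X Y j by (intro eq_vecI) (auto simp: Matrix.vec_eq_iff)
qed (use X Y in auto)

lemma left_inverse_imp_injective_mat:
  assumes "Y \<in> carrier_mat k m" "C \<in> carrier_mat m k" "Y * C = 1\<^sub>m k"
  shows "injective_mat C"
  unfolding injective_mat_def
proof (intro ballI impI)
  fix v assume v: "v \<in> carrier_vec (dim_col C)" "C *\<^sub>v v = 0\<^sub>v (dim_row C)"
  have "v = (Y * C) *\<^sub>v v" using assms v by simp
  also have "\<dots> = Y *\<^sub>v (C *\<^sub>v v)" using assms v by (intro assoc_mult_mat_vec) auto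
  also have "\<dots> = 0\<^sub>v k" using v assms by auto
  finally show "v = 0\<^sub>v (dim_col C)" using assms by simp
qed

text \<open>The columns are distinct, since two equal ones would put a difference of unit vectors
  into the kernel, and a nontrivial linear relation among them would be a nonzero kernel
  vector.\<close>

lemma injective_mat_rank:
  assumes C: "C \<in> carrier_mat m r" and "injective_mat C"
  shows "vec_space.rank m C = r"
proof -
  interpret vec_space "TYPE(real)" m .
  have dist: "distinct (cols C)"
    unfolding distinct_conv_nth
  proof (intro allI impI notI)
    fix i j assume ij: "i < length (cols C)" "j < length (cols C)" "i \<noteq> j" "cols C ! i = cols C ! j"
    then have ij': "i < r" "j < r" using C by auto
    \<comment> \<open>One-column matrices carry the unit vectors, so that cancellation for matrices
      applies; the two products are columns \<open>i\<close> and \<open>j\<close> of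
      \<open>C\<close>.\<close>
    have e: "C * mat_of_cols r [unit_vec r i] = C * mat_of_cols r [unit_vec r j]"
    proof (intro eq_matI)
      fix a b assume "a < dim_row (C * mat_of_cols r [unit_vec r j])" "b < dim_col (C * mat_of_cols r [unit_vec r j])"
      then show "(C * mat_of_cols r [unit_vec r i]) $$ (a, b) = (C * mat_of_cols r [unit_vec r j]) $$ (a, b)"
        using ij ij' C index_col[of a C i] index_col[of a C j] by auto
    qed auto
    have "mat_of_cols r [unit_vec r i] = mat_of_cols r [unit_vec r j :: real vec]"
      by (rule injective_mat_cancel[OF assms(2) C _ _ e]) auto
    then have "col (mat_of_cols r [unit_vec r i]) 0 = col (mat_of_cols r [unit_vec r j :: real vec]) 0" by simp
    then have "unit_vec r i = (unit_vec r j :: real vec)" by simp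
    then show False using ij ij' by simp
  qed
  have "lin_indpt (set (cols C))"
    using lin_depE[OF C _ dist] assms unfolding injective_mat_def by (metis carrier_matD)
  then show ?thesis using lin_indpt_full_rank[OF C dist] by simp
qed

section \<open>Rank factorization\<close>

text \<open>The columns of \<open>C\<close> are a maximal independent set of columns of
  \<open>M\<close>. They span the same range as \<open>M\<close>, and the two inclusions yield
  \<open>D\<close> and \<open>E\<close>.\<close>

lemma rank_factorization:
  fixes M :: "real mat"
  assumes M: "M \<in> carrier_mat m n" and "vec_space.rank m M = r"
  obtains C D E where "C \<in> carrier_mat m r" "D \<in> carrier_mat r n" "E \<in> carrier_mat n r"
    "injective_mat C" "M = C * D" "C = M * E"
proof -
  interpret vec_space "TYPE(real)" m .
  let ?P = "\<lambda>T. T \<subseteq> set (cols M) \<and> lin_indpt T"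
  have carr: "set (cols M) \<subseteq> carrier_vec m" using M cols_dim by blast
  have "lin_indpt {}" by (simp add: lin_dep_def)
  then obtain S where S: "finite S" "maximal S ?P"
    using maximal_exists_superset[of "set (cols M)" ?P "{}"] by auto
  have Ssub: "S \<subseteq> set (cols M)" and li: "lin_indpt S" using S by (auto simp: maximal_def)
  have card: "card S = r" using rank_card_indpt[OF M S(2)] assms by simp
  obtain xs where xs: "set xs = S" "distinct xs" using finite_distinct_list[OF S(1)] by blast
  have len: "length xs = r" using xs card distinct_card by fastforce
  define C where "C = mat_of_cols m xs"
  have colsC: "cols C = xs" using xs Ssub carr by (auto simp: C_def intro!: cols_mat_of_cols)
  have C: "C \<in> carrier_mat m r" using len by (auto simp: C_def)
  have inj: "injective_mat C"
    using lin_depI[OF C, unfolded colsC] li xs C unfolding injective_mat_def by auto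
  \<comment> \<open>A column outside the span could be added to \<open>S\<close> without losing
    independence, against maximality.\<close>
  have "set (cols M) \<subseteq> span S"
  proof
    fix s assume s: "s \<in> set (cols M)"
    show "s \<in> span S"
    proof (rule ccontr)
      assume ns: "s \<notin> span S"
      have "S \<subseteq> carrier_vec m" using Ssub carr by blast
      then have "s \<notin> S" using ns span_mem by blast
      moreover have "lin_indpt (S \<union> {s})"
        using lin_dep_iff_in_span[of S s] ns li \<open>S \<subseteq> carrier_vec m\<close> s carr \<open>s \<notin> S\<close> by auto
      ultimately show False using S(2) Ssub s unfolding maximal_def by blast
    qed
  qed
  then have "span (set (cols M)) \<subseteq> span S"
    using Ssub carr by (meson dual_order.trans span_is_submodule span_is_subset)
  moreover have "span S \<subseteq> span (set (cols M))" using Ssub by (rule span_is_monotone)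
  ultimately have "mat_range M = mat_range C"
    using M C xs colsC by (auto simp: mat_range_def col_space_def)
  then obtain D E where "D \<in> carrier_mat r n" "M = C * D" "E \<in> carrier_mat n r" "C = M * E"
    using mat_range_subset_iff[OF M C] mat_range_subset_iff[OF C M] by auto
  then show ?thesis using that C inj by blast
qed

lemma rank_cong_mat_range:
  assumes "A \<in> carrier_mat m k" "B \<in> carrier_mat m l" "mat_range A = mat_range B"
  shows "vec_space.rank m A = vec_space.rank m B"
  using assms by (simp add: mat_range_def vec_space.rank_def vec_space.col_space_def)

text \<open>In a rank factorization \<open>R = C * D\<close> the factor \<open>D\<close> is square
  here. Cancelling \<open>C\<close> in \<open>C * (D * E) = C\<close> makes \<open>E\<close> a right
  and hence a two-sided inverse of \<open>D\<close>, so \<open>C\<close> and \<open>D\<close> both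
  have trivial kernel.\<close>

lemma injective_mat_of_rank:
  assumes R: "R \<in> carrier_mat m r" and "vec_space.rank m R = r"
  shows "injective_mat R"
proof -
  obtain C D E where f: "C \<in> carrier_mat m r" "D \<in> carrier_mat r r" "E \<in> carrier_mat r r"
    "injective_mat C" "R = C * D" "C = R * E"
    using rank_factorization[OF assms] by blast
  have "C * (D * E) = C"
    by (simp only: assoc_mult_mat[OF f(1-3), symmetric] f(5)[symmetric] f(6)[symmetric])
  then have "C * (D * E) = C * 1\<^sub>m r" using f(1) by simp
  then have "D * E = 1\<^sub>m r"
    using injective_mat_cancel[OF f(4,1)] f by (metis mult_carrier_mat one_carrier_mat)
  then have "E * D = 1\<^sub>m r" using mat_mult_left_right_inverse f by blast
  then have injD: "injective_mat D" using left_inverse_imp_injective_mat f by blast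
  show ?thesis
    unfolding injective_mat_def
  proof (intro ballI impI)
    fix v assume v: "v \<in> carrier_vec (dim_col R)" "R *\<^sub>v v = 0\<^sub>v (dim_row R)"
    then have "C *\<^sub>v (D *\<^sub>v v) = 0\<^sub>v m" using R f(1,2,5) by simp
    moreover have "D *\<^sub>v v \<in> carrier_vec r"
      using v(1) R by (intro mult_mat_vec_carrier[OF f(2)]) simp
    ultimately have "D *\<^sub>v v = 0\<^sub>v r" using f(1,4) by (auto simp: injective_mat_def)
    then show "v = 0\<^sub>v (dim_col R)" using injD v R f(2) by (auto simp: injective_mat_def)
  qed
qed

section \<open>Gram matrices and the two projection formulas\<close>

text \<open>A kernel vector \<open>v\<close> of the Gram matrix satisfies
  \<open>(R *\<^sub>v v) \<bullet> (R *\<^sub>v v) = 0\<close>, and over the reals a vector with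
  vanishing sum of squares is zero.\<close>

lemma gram_invertible:
  assumes R: "R \<in> carrier_mat m r" and inj: "injective_mat R"
  obtains G where "G \<in> carrier_mat r r" "mat_inverse (R\<^sup>T * R) = Some G"
    "G * (R\<^sup>T * R) = 1\<^sub>m r" "(R\<^sup>T * R) * G = 1\<^sub>m r"
proof -
  have RR: "R\<^sup>T * R \<in> carrier_mat r r" using R by auto
  have "det (R\<^sup>T * R) \<noteq> 0"
  proof
    assume "det (R\<^sup>T * R) = 0"
    then obtain v where v: "v \<in> carrier_vec r" "v \<noteq> 0\<^sub>v r" "(R\<^sup>T * R) *\<^sub>v v = 0\<^sub>v r"
      using det_0_iff_vec_prod_zero_field[OF RR] by blast
    have "(R *\<^sub>v v) \<bullet> (R *\<^sub>v v) = v \<bullet> (R\<^sup>T *\<^sub>v (R *\<^sub>v v))"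
      using transpose_vec_mult_scalar[OF R v(1), of "R *\<^sub>v v"] R v
        comm_scalar_prod[of "R\<^sup>T *\<^sub>v (R *\<^sub>v v)" r v] by auto
    also have "\<dots> = 0" using v R by auto
    finally have "R *\<^sub>v v = 0\<^sub>v m"
      using R v by (intro eq_vecI) (auto simp: scalar_prod_def sum_nonneg_eq_0_iff simp flip: power2_eq_square)
    then show False using inj R v by (auto simp: injective_mat_def)
  qed
  then obtain G where G: "mat_inverse (R\<^sup>T * R) = Some G"
    using mat_inverse(1)[OF RR] det_non_zero_imp_unit[OF RR] by (metis not_None_eq)
  then show ?thesis using mat_inverse(2)[OF RR G] that by blast
qed

text \<open>With \<open>M = R * Z\<close> and \<open>G\<close> the inverse Gram matrix,
  \<open>G * R\<^sup>T * M\<close> collapses to the coefficient matrix \<open>Z\<close>.\<close>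

lemma rank_representation_gram:
  fixes M R :: "real mat"
  assumes M: "M \<in> carrier_mat m n" and R: "R \<in> carrier_mat m r" and inj: "injective_mat R"
    and sub: "mat_range M \<subseteq> mat_range R"
  shows "invertible_mat (R\<^sup>T * R)"
    and "M = R * the (mat_inverse (R\<^sup>T * R)) * R\<^sup>T * M"
    and "rank_representation r M R (the (mat_inverse (R\<^sup>T * R)) * R\<^sup>T * M)"
proof -
  obtain G where G: "G \<in> carrier_mat r r" "mat_inverse (R\<^sup>T * R) = Some G"
    "G * (R\<^sup>T * R) = 1\<^sub>m r" "(R\<^sup>T * R) * G = 1\<^sub>m r"
    using gram_invertible[OF R inj] by blast
  show "invertible_mat (R\<^sup>T * R)"
    using G R by (auto simp: invertible_mat_def inverts_mat_def simp del: assoc_mult_mat)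
  obtain Z where Z: "Z \<in> carrier_mat r n" "M = R * Z"
    using sub mat_range_subset_iff[OF M R] by blast
  have RT: "R\<^sup>T \<in> carrier_mat r m" using R by simp
  have "G * R\<^sup>T * M = G * (R\<^sup>T * R) * Z"
    unfolding Z(2) using assoc_mult_mat[OF G(1) RT, of "R * Z" n] assoc_mult_mat[OF RT R Z(1)]
      assoc_mult_mat[OF G(1) _ Z(1), of "R\<^sup>T * R"] R RT Z(1) by simp
  then have Zeq: "G * R\<^sup>T * M = Z" using G(3) Z(1) by simp
  have "R * G * R\<^sup>T * M = R * (G * R\<^sup>T) * M"
    by (simp only: assoc_mult_mat[OF R G(1) RT])
  also have "\<dots> = R * (G * R\<^sup>T * M)"
    using G(1) RT by (intro assoc_mult_mat[OF R _ M]) auto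
  finally show "M = R * the (mat_inverse (R\<^sup>T * R)) * R\<^sup>T * M"
    using Zeq Z(2) G(2) by (simp only: option.sel)
  show "rank_representation r M R (the (mat_inverse (R\<^sup>T * R)) * R\<^sup>T * M)"
    using Zeq Z G R by (auto simp: rank_representation_def)
qed

text \<open>Orthonormality makes \<open>U\<^sup>T\<close> a left inverse of \<open>U\<close>. Hence
  the number of columns of \<open>U\<close> is its rank, which is that of \<open>M\<close>, and
  \<open>U\<^sup>T * M\<close> recovers the coefficients \<open>Z\<close> in
  \<open>M = U * Z\<close>.\<close>

lemma rank_representation_orthonormal:
  fixes M U :: "real mat"
  assumes M: "M \<in> carrier_mat m n" and rank: "vec_space.rank m M = r"
    and U: "dim_row U = m" "orthonormal_cols U" and range: "mat_range U = mat_range M"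
  shows "M = U * U\<^sup>T * M" and "rank_representation r M U (U\<^sup>T * M)"
proof -
  define k where "k = dim_col U"
  have Uc: "U \<in> carrier_mat m k" and UT: "U\<^sup>T \<in> carrier_mat k m" using U by (auto simp: k_def)
  have orth: "U\<^sup>T * U = 1\<^sub>m k"
    using U(2) Uc by (intro eq_matI) (auto simp: orthonormal_cols_def)
  have "k = r"
    using injective_mat_rank[OF Uc left_inverse_imp_injective_mat[OF UT Uc orth]]
      rank_cong_mat_range[OF Uc M range] rank by simp
  obtain Z where Z: "Z \<in> carrier_mat k n" "M = U * Z"
    using range mat_range_subset_iff[OF M Uc] by blast
  have "U\<^sup>T * M = Z" unfolding Z(2)
    using Uc UT Z(1) orth by (simp flip: assoc_mult_mat)
  moreover have "U * U\<^sup>T * M = U * (U\<^sup>T * M)" using Uc UT M by simp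
  ultimately show "M = U * U\<^sup>T * M" and "rank_representation r M U (U\<^sup>T * M)"
    using Z M Uc \<open>k = r\<close> by (auto simp: rank_representation_def)
qed

section \<open>The determinant criterion for preserving the range\<close>

text \<open>Since \<open>M * B = C * (D * B)\<close> with \<open>C\<close> injective, equal ranges
  give the square matrix \<open>D * B\<close> a right inverse. Conversely, a right inverse
  \<open>Y\<close> of \<open>D * B\<close> gives \<open>M = M * B * (Y * D)\<close>.\<close>

lemma mat_range_mult_eq_iff_det:
  assumes C: "C \<in> carrier_mat m r" and D: "D \<in> carrier_mat r n" and E: "E \<in> carrier_mat n r"
    and inj: "injective_mat C" and MCD: "M = C * D" and CME: "C = M * E" and B: "B \<in> carrier_mat n r"
  shows "mat_range (M * B) = mat_range M \<longleftrightarrow> det (D * B) \<noteq> 0"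
proof
  have M: "M \<in> carrier_mat m n" and MB: "M * B \<in> carrier_mat m r" and DB: "D * B \<in> carrier_mat r r"
    using C D B MCD by auto
  have MB_eq: "M * B = C * (D * B)" using C D B MCD by simp
  {
    assume "mat_range (M * B) = mat_range M"
    moreover have "mat_range C \<subseteq> mat_range M"
      using mat_range_mult_subset[OF M E] by (simp only: CME[symmetric])
    ultimately obtain X where X: "X \<in> carrier_mat r r" "C = M * B * X"
      using mat_range_subset_iff[OF C MB] by auto
    have "C * (D * B * X) = C * 1\<^sub>m r"
      using X(2) MB_eq assoc_mult_mat[OF C DB X(1)] right_mult_one_mat[OF C] by simp
    then have "D * B * X = 1\<^sub>m r"
      using injective_mat_cancel[OF inj C] DB X by (metis mult_carrier_mat one_carrier_mat)
    then have "det (D * B) * det X = 1"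
      using det_mult[OF DB X(1)] by simp
    then show "det (D * B) \<noteq> 0" by auto
  next
    assume "det (D * B) \<noteq> 0"
    then obtain Y where Y: "Y \<in> carrier_mat r r" "D * B * Y = 1\<^sub>m r"
      using det_non_zero_imp_unit[OF DB] by (auto simp: Units_def ring_mat_def)
    have "M * B * (Y * D) = C * ((D * B) * (Y * D))"
      unfolding MB_eq using Y D by (intro assoc_mult_mat[OF C DB]) auto
    also have "(D * B) * (Y * D) = D * B * Y * D"
      by (rule assoc_mult_mat[OF DB Y(1) D, symmetric])
    also have "C * \<dots> = M" using Y(2) D MCD by simp
    finally have "M * B * (Y * D) = M" .
    then have "mat_range M \<subseteq> mat_range (M * B)"
      using mat_range_mult_subset[OF MB mult_carrier_mat[OF Y(1) D]] by (simp only:)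
    moreover have "mat_range (M * B) \<subseteq> mat_range M"
      by (rule mat_range_mult_subset[OF M B])
    ultimately show "mat_range (M * B) = mat_range M" by simp
  }
qed

section \<open>Zeros of multiaffine polynomials, and determinants as such polynomials\<close>

text \<open>A multiaffine polynomial is encoded by an index set \<open>Q\<close> of monomials:
  \<open>a q\<close> is the coefficient and \<open>\<tau> q\<close> the set of variables, each to
  the first power. Different indices may share a set of variables.\<close>

lemma borel_measurable_multiaffine:
  fixes L :: "real measure"
  assumes L: "sets L = sets borel" and fin: "finite Q" and sub: "\<And>q. q \<in> Q \<Longrightarrow> \<tau> q \<subseteq> I"
  shows "(\<lambda>x. \<Sum>q\<in>Q. a q * (\<Prod>e\<in>\<tau> q. x e)) \<in> borel_measurable (PiM I (\<lambda>_. L))"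
proof (intro borel_measurable_sum borel_measurable_times borel_measurable_const borel_measurable_prod)
  fix q e assume "q \<in> Q" "e \<in> \<tau> q"
  then have "(\<lambda>x. x e) \<in> measurable (PiM I (\<lambda>_. L)) L"
    using sub by (intro measurable_component_singleton) auto
  then show "(\<lambda>x. x e) \<in> borel_measurable (PiM I (\<lambda>_. L))"
    using measurable_cong_sets[OF refl L] by blast
qed

text \<open>A Schwartz--Zippel bound for a law without atoms of mass above \<open>p\<close>. Along a variable \<open>i\<close> write
  \<open>f = x\<^sub>i * g + h\<close>. Where \<open>g\<close> vanishes the induction hypothesis for degree \<open>d - 1\<close> applies; elsewhere
  at most one value of \<open>x\<^sub>i\<close> is a zero of \<open>f\<close>.\<close>

lemma emeasure_multiaffine_zeros_le:
  fixes L :: "real measure" and a :: "'q \<Rightarrow> real" and \<tau> :: "'q \<Rightarrow> 'i set" and p :: ennreal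
  assumes L: "prob_space L" "sets L = sets borel" and atom: "\<And>x. emeasure L {x} \<le> p"
    and "finite I" "finite Q" "\<And>q. q \<in> Q \<Longrightarrow> \<tau> q \<subseteq> I" "\<And>q. q \<in> Q \<Longrightarrow> card (\<tau> q) \<le> d"
    and "(\<Sum>q\<in>Q. a q * (\<Prod>e\<in>\<tau> q. x\<^sub>0 e)) \<noteq> 0"
  shows "emeasure (PiM I (\<lambda>_. L)) {x \<in> space (PiM I (\<lambda>_. L)). (\<Sum>q\<in>Q. a q * (\<Prod>e\<in>\<tau> q. x e)) = 0}
    \<le> of_nat d * p"
  using assms(4-)
proof (induction I arbitrary: Q \<tau> d x\<^sub>0 rule: finite_induct)
  \<comment> \<open>Without variables the polynomial is a constant, nonzero by its value at
    \<open>x\<^sub>0\<close>, so it has no zeros.\<close>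
  case empty
  have "\<tau> q = {}" if "q \<in> Q" for q using empty that by auto
  then have "(\<Sum>q\<in>Q. a q * (\<Prod>e\<in>\<tau> q. x e)) = (\<Sum>q\<in>Q. a q * (\<Prod>e\<in>\<tau> q. x\<^sub>0 e))" for x
    by (intro sum.cong) auto
  with empty show ?case by simp
next
  case (insert i I)
  interpret L: prob_space L by fact
  interpret product_prob_space "\<lambda>_. L" by unfold_locales
  interpret PI: prob_space "PiM I (\<lambda>_. L)" by (intro prob_space_PiM) (rule L)
  define f where "f = (\<lambda>x. \<Sum>q\<in>Q. a q * (\<Prod>e\<in>\<tau> q. x e))"
  define g where "g = (\<lambda>x. \<Sum>q\<in>{q\<in>Q. i \<in> \<tau> q}. a q * (\<Prod>e\<in>\<tau> q - {i}. x e))"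
  define h where "h = (\<lambda>x. \<Sum>q\<in>{q\<in>Q. i \<notin> \<tau> q}. a q * (\<Prod>e\<in>\<tau> q. x e))"
  have fin: "finite (\<tau> q)" if "q \<in> Q" for q
    using insert that by (meson finite.insertI finite_subset)
  have split: "f (x(i := y)) = y * g x + h x" for x y
  proof -
    have "f (x(i := y)) = (\<Sum>q\<in>{q\<in>Q. i \<in> \<tau> q}. a q * (\<Prod>e\<in>\<tau> q. (x(i := y)) e))
        + (\<Sum>q\<in>{q\<in>Q. i \<notin> \<tau> q}. a q * (\<Prod>e\<in>\<tau> q. (x(i := y)) e))"
      unfolding f_def using insert.prems(1)
      by (subst sum.union_disjoint [symmetric]) (auto intro!: sum.cong)
    also have "(\<Sum>q\<in>{q\<in>Q. i \<in> \<tau> q}. a q * (\<Prod>e\<in>\<tau> q. (x(i := y)) e)) = y * g x"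
      unfolding g_def sum_distrib_left
    proof (intro sum.cong refl)
      fix q assume q: "q \<in> {q\<in>Q. i \<in> \<tau> q}"
      have "(\<Prod>e\<in>\<tau> q. (x(i := y)) e) = y * (\<Prod>e\<in>\<tau> q - {i}. (x(i := y)) e)"
        using q fin by (subst prod.remove[of _ i]) auto
      also have "(\<Prod>e\<in>\<tau> q - {i}. (x(i := y)) e) = (\<Prod>e\<in>\<tau> q - {i}. x e)"
        by (intro prod.cong) auto
      finally show "a q * (\<Prod>e\<in>\<tau> q. (x(i := y)) e) = y * (a q * (\<Prod>e\<in>\<tau> q - {i}. x e))"
        by simp
    qed
    also have "(\<Sum>q\<in>{q\<in>Q. i \<notin> \<tau> q}. a q * (\<Prod>e\<in>\<tau> q. (x(i := y)) e)) = h x"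
      unfolding h_def by (intro sum.cong prod.cong refl arg_cong2[where f="(*)"]) auto
    finally show ?thesis .
  qed
  have f_meas [measurable]: "f \<in> borel_measurable (PiM (insert i I) (\<lambda>_. L))"
    unfolding f_def using insert.prems by (intro borel_measurable_multiaffine L) auto
  have g_meas [measurable]: "g \<in> borel_measurable (PiM I (\<lambda>_. L))"
    unfolding g_def using insert.prems by (intro borel_measurable_multiaffine L) auto
  have h_meas [measurable]: "h \<in> borel_measurable (PiM I (\<lambda>_. L))"
    unfolding h_def using insert.prems by (intro borel_measurable_multiaffine L) auto
  have "emeasure (PiM (insert i I) (\<lambda>_. L)) {x \<in> space (PiM (insert i I) (\<lambda>_. L)). f x = 0}
      = (\<integral>\<^sup>+x. indicator {x \<in> space (PiM (insert i I) (\<lambda>_. L)). f x = 0} x \<partial>PiM (insert i I) (\<lambda>_. L))"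
    by (simp add: nn_integral_indicator)
  \<comment> \<open>Fubini: the coordinate \<open>i\<close> is integrated first, with the other
    coordinates fixed.\<close>
  also have "\<dots> = (\<integral>\<^sup>+x. \<integral>\<^sup>+y. indicator {x \<in> space (PiM (insert i I) (\<lambda>_. L)). f x = 0} (x(i := y)) \<partial>L \<partial>PiM I (\<lambda>_. L))"
    using insert.hyps by (intro product_nn_integral_insert) auto
  also have "\<dots> \<le> (\<integral>\<^sup>+x. emeasure L {y. y * g x + h x = 0} \<partial>PiM I (\<lambda>_. L))"
  proof (intro nn_integral_mono)
    fix x
    have "(\<integral>\<^sup>+y. indicator {x \<in> space (PiM (insert i I) (\<lambda>_. L)). f x = 0} (x(i := y)) \<partial>L)
        \<le> (\<integral>\<^sup>+y. indicator {y. y * g x + h x = 0} y \<partial>L)"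
      by (intro nn_integral_mono) (auto simp: split indicator_def)
    also have "\<dots> = emeasure L {y. y * g x + h x = 0}"
      using L(2) by (intro nn_integral_indicator) auto
    finally show "(\<integral>\<^sup>+y. indicator {x \<in> space (PiM (insert i I) (\<lambda>_. L)). f x = 0} (x(i := y)) \<partial>L)
        \<le> emeasure L {y. y * g x + h x = 0}" .
  qed
  also have "\<dots> \<le> of_nat d * p"
  proof (cases "\<forall>x. g x = 0")
    \<comment> \<open>Here \<open>f\<close> does not depend on the coordinate \<open>i\<close> and
      agrees with \<open>h\<close>, so the induction hypothesis is used with \<open>d\<close>
      unchanged.\<close>
    case True
    have "h x\<^sub>0 \<noteq> 0"
      using insert.prems(4) split[of x\<^sub>0 "x\<^sub>0 i"] True by (simp add: f_def)
    have "(\<integral>\<^sup>+x. emeasure L {y. y * g x + h x = 0} \<partial>PiM I (\<lambda>_. L))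
        \<le> (\<integral>\<^sup>+x. indicator {x \<in> space (PiM I (\<lambda>_. L)). h x = 0} x \<partial>PiM I (\<lambda>_. L))"
      by (intro nn_integral_mono) (auto simp: True indicator_def intro: L.emeasure_le_1)
    also have "\<dots> = emeasure (PiM I (\<lambda>_. L)) {x \<in> space (PiM I (\<lambda>_. L)). h x = 0}"
      by (intro nn_integral_indicator) measurable
    also have "\<dots> \<le> of_nat d * p"
      unfolding h_def
    proof (rule insert.IH)
      show "(\<Sum>q\<in>{q\<in>Q. i \<notin> \<tau> q}. a q * (\<Prod>e\<in>\<tau> q. x\<^sub>0 e)) \<noteq> 0"
        using \<open>h x\<^sub>0 \<noteq> 0\<close> by (simp add: h_def)
    qed (use insert.prems in auto)
    finally show ?thesis .
  next
    case False
    then obtain x\<^sub>1 where x1: "g x\<^sub>1 \<noteq> 0" by blast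
    \<comment> \<open>A nonzero \<open>g\<close> forces a monomial containing \<open>i\<close>, so
      \<open>d\<close> is positive and \<open>d - 1\<close> is a genuine degree bound for
      \<open>g\<close>.\<close>
    then obtain q where q: "q \<in> Q" "i \<in> \<tau> q"
      unfolding g_def by (metis (mono_tags, lifting) mem_Collect_eq sum.not_neutral_contains_not_neutral)
    then have "card (\<tau> q) > 0" using fin by (auto simp: card_gt_0_iff)
    then have "d > 0" using insert.prems(3)[OF q(1)] by linarith
    then obtain d' where d': "d = Suc d'" using gr0_implies_Suc by blast
    \<comment> \<open>The fibre over \<open>x\<close> has measure at most 1 where \<open>g\<close>
      vanishes and at most \<open>p\<close> elsewhere.\<close>
    have "(\<integral>\<^sup>+x. emeasure L {y. y * g x + h x = 0} \<partial>PiM I (\<lambda>_. L))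
        \<le> (\<integral>\<^sup>+x. indicator {x \<in> space (PiM I (\<lambda>_. L)). g x = 0} x + p \<partial>PiM I (\<lambda>_. L))"
    proof (intro nn_integral_mono)
      fix x assume x: "x \<in> space (PiM I (\<lambda>_. L))"
      show "emeasure L {y. y * g x + h x = 0} \<le> indicator {x \<in> space (PiM I (\<lambda>_. L)). g x = 0} x + p"
      proof (cases "g x = 0")
        case True
        have "emeasure L {y. y * g x + h x = 0} \<le> 1 + 0" using L.emeasure_le_1 by simp
        also have "\<dots> \<le> 1 + p" by (intro add_mono) auto
        finally show ?thesis using True x by simp
      next
        case False
        then have "{y. y * g x + h x = 0} = {- h x / g x}"
          by (auto simp: field_simps add_eq_0_iff)
        then show ?thesis using atom[of "- h x / g x"] False by simp
      qed
    qed
    also have "\<dots> = emeasure (PiM I (\<lambda>_. L)) {x \<in> space (PiM I (\<lambda>_. L)). g x = 0} + p"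
      by (subst nn_integral_add) (auto simp: PI.emeasure_space_1)
    also have "emeasure (PiM I (\<lambda>_. L)) {x \<in> space (PiM I (\<lambda>_. L)). g x = 0} \<le> of_nat d' * p"
      unfolding g_def
    proof (rule insert.IH)
      show "(\<Sum>q\<in>{q\<in>Q. i \<in> \<tau> q}. a q * (\<Prod>e\<in>\<tau> q - {i}. x\<^sub>1 e)) \<noteq> 0"
        using x1 by (simp add: g_def)
      show "card (\<tau> q - {i}) \<le> d'" if "q \<in> {q\<in>Q. i \<in> \<tau> q}" for q
        using that insert.prems(3)[of q] fin[of q] d' by auto
    qed (use insert.prems in auto)
    finally show ?thesis using d' by (simp add: algebra_simps add_mono)
  qed
  finally show ?case by (simp add: f_def)
qed

text \<open>The index \<open>(\<pi>, f)\<close> stands for the term that picks the permutation \<open>\<pi>\<close> in the Leibniz formula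
  and the summand \<open>f i\<close> in the entry \<open>(i, \<pi> i)\<close> of the product.\<close>

lemma det_mult_multiaffine:
  fixes D :: "real mat"
  assumes D: "D \<in> carrier_mat r n"
  obtains Q :: "((nat \<Rightarrow> nat) \<times> (nat \<Rightarrow> nat)) set" and \<tau> a
  where "finite Q" "\<And>q. q \<in> Q \<Longrightarrow> \<tau> q \<subseteq> {..<n} \<times> {..<r}" "\<And>q. q \<in> Q \<Longrightarrow> card (\<tau> q) \<le> r"
    "\<And>B. B \<in> carrier_mat n r \<Longrightarrow> det (D * B) = (\<Sum>q\<in>Q. a q * (\<Prod>e\<in>\<tau> q. B $$ e))"
proof
  let ?F = "PiE {0..<r} (\<lambda>_. {0..<n})"
  let ?S = "{\<pi>. \<pi> permutes {0..<r}}"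
  let ?a = "\<lambda>(\<pi>, f). signof \<pi> * (\<Prod>i = 0..<r. D $$ (i, f i))"
  let ?\<tau> = "\<lambda>(\<pi>, f). (\<lambda>i. (f i, \<pi> i)) ` {0..<r}"
  show "finite (?S \<times> ?F)"
    by (intro finite_cartesian_product finite_permutations finite_PiE) auto
  show "?\<tau> q \<subseteq> {..<n} \<times> {..<r}" if "q \<in> ?S \<times> ?F" for q
    using that by (auto simp: PiE_iff dest: permutes_in_image[of _ "{0..<r}"])
  show "card (?\<tau> q) \<le> r" for q
    using card_image_le[of "{0..<r}"] by (auto split: prod.split)
  fix B :: "real mat" assume B: "B \<in> carrier_mat n r"
  have "det (D * B) = (\<Sum>\<pi>\<in>?S. signof \<pi> * (\<Prod>i = 0..<r. (D * B) $$ (i, \<pi> i)))"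
    using D B by (intro det_def') auto
  also have "\<dots> = (\<Sum>\<pi>\<in>?S. \<Sum>f\<in>?F. ?a (\<pi>, f) * (\<Prod>e\<in>?\<tau> (\<pi>, f). B $$ e))"
  proof (intro sum.cong refl)
    fix \<pi> assume \<pi>: "\<pi> \<in> ?S"
    have "(\<Prod>i = 0..<r. (D * B) $$ (i, \<pi> i)) = (\<Prod>i = 0..<r. \<Sum>k\<in>{0..<n}. D $$ (i, k) * B $$ (k, \<pi> i))"
      using D B \<pi> permutes_in_image[of \<pi> "{0..<r}"]
      by (intro prod.cong refl) (auto simp: scalar_prod_def intro!: sum.cong)
    \<comment> \<open>Distributivity: expanding the product of sums chooses one summand
      \<open>f i\<close> for each row \<open>i\<close>.\<close>
    also have "\<dots> = (\<Sum>f\<in>?F. \<Prod>i = 0..<r. D $$ (i, f i) * B $$ (f i, \<pi> i))"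
      by (intro prod_sum_PiE) auto
    also have "\<dots> = (\<Sum>f\<in>?F. (\<Prod>i = 0..<r. D $$ (i, f i)) * (\<Prod>e\<in>?\<tau> (\<pi>, f). B $$ e))"
    proof (intro sum.cong refl)
      fix f :: "nat \<Rightarrow> nat"
      \<comment> \<open>A permutation never repeats a column index, so the chosen entries of
        \<open>B\<close> are distinct. This makes every monomial multiaffine.\<close>
      have "inj_on (\<lambda>i. (f i, \<pi> i)) {0..<r}"
        using \<pi> permutes_inj[of \<pi> "{0..<r}"] by (auto simp: inj_on_def inj_def)
      then show "(\<Prod>i = 0..<r. D $$ (i, f i) * B $$ (f i, \<pi> i))
          = (\<Prod>i = 0..<r. D $$ (i, f i)) * (\<Prod>e\<in>?\<tau> (\<pi>, f). B $$ e)"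
        by (simp add: prod.reindex prod.distrib)
    qed
    finally show "signof \<pi> * (\<Prod>i = 0..<r. (D * B) $$ (i, \<pi> i))
        = (\<Sum>f\<in>?F. ?a (\<pi>, f) * (\<Prod>e\<in>?\<tau> (\<pi>, f). B $$ e))"
      by (simp add: sum_distrib_left mult.assoc)
  qed
  also have "\<dots> = (\<Sum>q\<in>?S \<times> ?F. ?a q * (\<Prod>e\<in>?\<tau> q. B $$ e))"
    by (simp add: sum.cartesian_product case_prod_unfold)
  finally show "det (D * B) = (\<Sum>q\<in>?S \<times> ?F. ?a q * (\<Prod>e\<in>?\<tau> q. B $$ e))" .
qed

section \<open>Random matrices with independent, identically distributed entries\<close>

text \<open>Independence says that the joint law is the product of the marginals, all equal to
  \<open>L\<close>. Positive dimensions keep the index set nonempty, as this characterization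
  requires.\<close>

lemma iid_mat_distr:
  assumes "prob_space P" and iid: "iid_mat P L n r B" and "0 < n" "0 < r"
  shows "distr P (\<Pi>\<^sub>M e\<in>{..<n} \<times> {..<r}. borel) (\<lambda>\<omega>. \<lambda>e\<in>{..<n} \<times> {..<r}. B \<omega> $$ e)
    = (\<Pi>\<^sub>M e\<in>{..<n} \<times> {..<r}. L)"
proof -
  interpret prob_space P by fact
  let ?I = "{..<n} \<times> {..<r}"
  let ?X = "\<lambda>e \<omega>. B \<omega> $$ e"
  have indep: "indep_vars (\<lambda>_. borel) ?X ?I"
    using iid by (simp add: iid_mat_def case_prod_unfold)
  have "distr P (\<Pi>\<^sub>M e\<in>?I. borel) (\<lambda>\<omega>. \<lambda>e\<in>?I. ?X e \<omega>) = (\<Pi>\<^sub>M e\<in>?I. distr P borel (?X e))"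
    using indep assms(3,4)
    by (subst indep_vars_iff_distr_eq_PiM'[symmetric]) (auto simp: indep_vars_def)
  also have "\<dots> = (\<Pi>\<^sub>M e\<in>?I. L)"
    using iid by (intro PiM_cong) (auto simp: iid_mat_def)
  finally show ?thesis .
qed

text \<open>The event is the preimage, under the map from outcomes to matrix entries, of the zero
  set of a multiaffine polynomial, and the law of that map is a product measure.\<close>

lemma prob_det_zero_le:
  assumes P: "prob_space P" and iid: "iid_mat P L n r B"
    and L: "prob_space L" "sets L = sets borel" and atom: "\<And>x. emeasure L {x} \<le> ennreal p" and "0 \<le> p"
    and D: "D \<in> carrier_mat r n" and E: "E \<in> carrier_mat n r" "det (D * E) \<noteq> 0"
  shows "{\<omega> \<in> space P. det (D * B \<omega>) = 0} \<in> sets P"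
    and "measure P {\<omega> \<in> space P. det (D * B \<omega>) = 0} \<le> real r * p"
proof -
  interpret prob_space P by fact
  have B: "B \<omega> \<in> carrier_mat n r" if "\<omega> \<in> space P" for \<omega>
    using iid that by (auto simp: iid_mat_def)
  have "{\<omega> \<in> space P. det (D * B \<omega>) = 0} \<in> sets P
    \<and> emeasure P {\<omega> \<in> space P. det (D * B \<omega>) = 0} \<le> of_nat r * ennreal p"
  \<comment> \<open>In the degenerate case \<open>D * B \<omega>\<close> has no entries or only
    empty sums as entries. It therefore equals \<open>D * E\<close>, and the event is empty.\<close>
  proof (cases "n = 0 \<or> r = 0")
    case True
    have "D * B \<omega> = D * E" if "\<omega> \<in> space P" for \<omega>
      using B[OF that] D E True by (intro eq_matI) (auto simp: scalar_prod_def)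
    then have "{\<omega> \<in> space P. det (D * B \<omega>) = 0} = {}" using E by auto
    then show ?thesis by (simp only: emeasure_empty sets.empty_sets zero_le simp_thms)
  next
    case False
    let ?I = "{..<n} \<times> {..<r}"
    let ?N = "\<Pi>\<^sub>M e\<in>?I. L"
    let ?X = "\<lambda>\<omega>. \<lambda>e\<in>?I. B \<omega> $$ e"
    obtain Q :: "((nat \<Rightarrow> nat) \<times> (nat \<Rightarrow> nat)) set" and \<tau> a
      where Q: "finite Q" "\<And>q. q \<in> Q \<Longrightarrow> \<tau> q \<subseteq> ?I" "\<And>q. q \<in> Q \<Longrightarrow> card (\<tau> q) \<le> r"
      and det: "\<And>B. B \<in> carrier_mat n r \<Longrightarrow> det (D * B) = (\<Sum>q\<in>Q. a q * (\<Prod>e\<in>\<tau> q. B $$ e))"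
      by (rule det_mult_multiaffine[OF D]) blast
    let ?f = "\<lambda>x. \<Sum>q\<in>Q. a q * (\<Prod>e\<in>\<tau> q. x e)"
    let ?Z = "{x \<in> space ?N. ?f x = 0}"
    have [measurable]: "?f \<in> borel_measurable ?N"
      using Q L by (intro borel_measurable_multiaffine) auto
    have Z: "?Z \<in> sets ?N" by measurable
    have X: "?X \<in> measurable P (\<Pi>\<^sub>M e\<in>?I. borel)"
      using iid by (intro measurable_restrict) (auto simp: iid_mat_def indep_vars_def)
    have sets_N: "sets (\<Pi>\<^sub>M e\<in>?I. borel) = sets ?N"
      using L by (intro sets_PiM_cong) auto
    have f: "?f (?X \<omega>) = det (D * B \<omega>)" if "\<omega> \<in> space P" for \<omega>
      unfolding det[OF B[OF that]] using Q(2) by (intro sum.cong prod.cong refl arg_cong2[where f="(*)"]) auto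
    have preimage: "?X -` ?Z \<inter> space P = {\<omega> \<in> space P. det (D * B \<omega>) = 0}"
      using f measurable_space[OF X] sets_eq_imp_space_eq[OF sets_N] by auto
    have "emeasure ?N ?Z = emeasure P (?X -` ?Z \<inter> space P)"
      using False Z sets_N X
      by (subst iid_mat_distr[OF P iid, symmetric]) (auto simp: emeasure_distr)
    \<comment> \<open>The entries of \<open>E\<close> are a point at which the polynomial does not
      vanish.\<close>
    moreover have "emeasure ?N ?Z \<le> of_nat r * ennreal p"
      using E Q by (intro emeasure_multiaffine_zeros_le[OF L atom, where x\<^sub>0 = "\<lambda>e. E $$ e"])
        (auto simp flip: det)
    moreover have "?X -` ?Z \<inter> space P \<in> sets P"
      using Z by (intro measurable_sets[OF X]) (simp only: sets_N)
    ultimately show ?thesis unfolding preimage by simp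
  qed
  then show "{\<omega> \<in> space P. det (D * B \<omega>) = 0} \<in> sets P"
    and "measure P {\<omega> \<in> space P. det (D * B \<omega>) = 0} \<le> real r * p"
    using \<open>0 \<le> p\<close> by (auto simp: emeasure_eq_measure ennreal_of_nat_eq_real_of_nat simp flip: ennreal_mult)
qed

text \<open>By the determinant criterion the event is the complement of
  \<open>det (D * B \<omega>) = 0\<close>, to which the zero bound applies.\<close>

lemma prob_mat_range_mult_eq_ge:
  assumes M: "M \<in> carrier_mat m n" "vec_space.rank m M = r"
    and P: "prob_space P" and iid: "iid_mat P L n r B"
    and L: "prob_space L" "sets L = sets borel" and atom: "\<And>x. emeasure L {x} \<le> ennreal p" and p: "0 \<le> p"
  shows "measure P {\<omega> \<in> space P. mat_range (M * B \<omega>) = mat_range M} \<ge> 1 - real r * p"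
proof -
  interpret prob_space P by fact
  obtain C D E where f: "C \<in> carrier_mat m r" "D \<in> carrier_mat r n" "E \<in> carrier_mat n r"
    "injective_mat C" "M = C * D" "C = M * E"
    using rank_factorization[OF M] by blast
  \<comment> \<open>The fixed matrix \<open>E\<close> preserves the range, so the same criterion
    shows that the determinant polynomial is not identically zero.\<close>
  have "mat_range (M * E) = mat_range M"
  proof
    show "mat_range (M * E) \<subseteq> mat_range M" by (rule mat_range_mult_subset[OF M(1) f(3)])
    show "mat_range M \<subseteq> mat_range (M * E)"
      using mat_range_mult_subset[OF f(1,2)] by (simp only: f(5,6)[symmetric])
  qed
  then have "det (D * E) \<noteq> 0"
    using mat_range_mult_eq_iff_det[OF f f(3)] by simp
  note Z = prob_det_zero_le[OF P iid L atom p f(2,3) this]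
  have "{\<omega> \<in> space P. mat_range (M * B \<omega>) = mat_range M} = space P - {\<omega> \<in> space P. det (D * B \<omega>) = 0}"
    using mat_range_mult_eq_iff_det[OF f] iid by (auto simp: iid_mat_def)
  then show ?thesis using Z prob_compl[OF Z(1)] by simp
qed

section \<open>Atoms of the normal and the uniform law\<close>

lemma emeasure_std_normal_distribution_singleton: "emeasure std_normal_distribution {x} = 0"
proof -
  have "emeasure (density lborel (\<lambda>x. ennreal (std_normal_density x))) {x}
      = (\<integral>\<^sup>+y. ennreal (std_normal_density y) * indicator {x} y \<partial>lborel)"
    by (intro emeasure_density) auto
  also have "\<dots> = 0"
    by (simp add: nn_integral_indicator_singleton)
  finally show ?thesis by simp
qed

text \<open>The point \<open>x\<close> may lie outside \<open>S\<close>, hence an inequality: the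
  preimage of \<open>{x}\<close> is \<open>{x} \<inter> S\<close>, which has at most one
  element.\<close>

lemma
  assumes "finite S" "S \<noteq> {}"
  shows prob_space_distr_uniform: "prob_space (distr (uniform_count_measure S) borel (\<lambda>x. x :: real))"
    and emeasure_distr_uniform_singleton_le:
      "emeasure (distr (uniform_count_measure S) borel (\<lambda>x. x :: real)) {x} \<le> ennreal (1 / real (card S))"
proof -
  have meas: "(\<lambda>x. x) \<in> measurable (uniform_count_measure S) borel"
    by (auto simp: measurable_def space_uniform_count_measure sets_uniform_count_measure)
  show "prob_space (distr (uniform_count_measure S) borel (\<lambda>x. x :: real))"
    using assms meas by (intro prob_space.prob_space_distr prob_space_uniform_count_measure)
  have "emeasure (distr (uniform_count_measure S) borel (\<lambda>x. x)) {x} = emeasure (uniform_count_measure S) ({x} \<inter> S)"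
    using meas by (simp add: emeasure_distr space_uniform_count_measure)
  also have "\<dots> = ennreal (real (card ({x} \<inter> S)) / real (card S))"
    using assms by (subst emeasure_uniform_count_measure) auto
  also have "\<dots> \<le> ennreal (1 / real (card S))"
    using card_mono[of "{x}" "{x} \<inter> S"] by (intro ennreal_leI divide_right_mono) auto
  finally show "emeasure (distr (uniform_count_measure S) borel (\<lambda>x. x)) {x} \<le> ennreal (1 / real (card S))" .
qed

text \<open>\<open>mat_inverse\<close> returns an option; the conjunct on
  \<open>invertible_mat\<close> ensures that \<open>the\<close> extracts a genuine inverse. The type
  variable \<open>'w\<close> leaves the sample space arbitrary.\<close>

theorem theorem4p1:
  fixes M :: "real mat" and m n r :: nat
  assumes "M \<in> carrier_mat m n"
    and "vec_space.rank m M = r"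
    and "r \<le> n" and "n \<le> m"
  shows
    "(\<forall>R. R \<in> carrier_mat m r \<longrightarrow> mat_range R = mat_range M \<longrightarrow>
        invertible_mat (R\<^sup>T * R) \<and>
        M = R * the (mat_inverse (R\<^sup>T * R)) * R\<^sup>T * M \<and>
        rank_representation r M R (the (mat_inverse (R\<^sup>T * R)) * R\<^sup>T * M) \<and>
        (\<forall>U. column_orthogonalization R U \<longrightarrow>
           M = U * U\<^sup>T * M \<and>
           rank_representation r M U (U\<^sup>T * M)))
     \<and>
     (\<forall>(P :: 'w measure) B. prob_space P \<longrightarrow> gaussian_mat P n r B \<longrightarrow>
        measure P {\<omega> \<in> space P. mat_range (M * B \<omega>) = mat_range M} = 1)
     \<and>
     (\<forall>(P :: 'w measure) B (S :: real set).
        prob_space P \<longrightarrow> finite S \<longrightarrow> S \<noteq> {} \<longrightarrow> uniform_mat P S n r B \<longrightarrow>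
        measure P {\<omega> \<in> space P. mat_range (M * B \<omega>) = mat_range M} \<ge> 1 - real r / real (card S))"
proof (intro conjI allI impI)
  fix R assume R: "R \<in> carrier_mat m r" "mat_range R = mat_range M"
  have "injective_mat R"
    using injective_mat_of_rank[OF R(1)] rank_cong_mat_range[OF R(1) assms(1) R(2)] assms(2) by simp
  note gram = rank_representation_gram[OF assms(1) R(1) this equalityD2[OF R(2)]]
  show "invertible_mat (R\<^sup>T * R)"
    "M = R * the (mat_inverse (R\<^sup>T * R)) * R\<^sup>T * M"
    "rank_representation r M R (the (mat_inverse (R\<^sup>T * R)) * R\<^sup>T * M)"
    by (fact gram)+
  fix U assume "column_orthogonalization R U"
  then have U: "dim_row U = m" "orthonormal_cols U" "mat_range U = mat_range M"
    using R by (auto simp: column_orthogonalization_def)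
  show "M = U * U\<^sup>T * M" "rank_representation r M U (U\<^sup>T * M)"
    by (fact rank_representation_orthonormal[OF assms(1,2) U])+
next
  fix P :: "'w measure" and B
  assume P: "prob_space P" and "gaussian_mat P n r B"
  then have iid: "iid_mat P std_normal_distribution n r B" by (simp add: gaussian_mat_def)
  \<comment> \<open>The factor 0 is kept to match the general bound at \<open>p = 0\<close>.\<close>
  have "measure P {\<omega> \<in> space P. mat_range (M * B \<omega>) = mat_range M} \<ge> 1 - real r * 0"
    by (rule prob_mat_range_mult_eq_ge[OF assms(1,2) P iid])
      (auto simp: prob_space_normal_density emeasure_std_normal_distribution_singleton)
  then show "measure P {\<omega> \<in> space P. mat_range (M * B \<omega>) = mat_range M} = 1"
    using prob_space.prob_le_1[OF P] by (simp add: order_antisym)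
next
  fix P :: "'w measure" and B and S :: "real set"
  assume P: "prob_space P" and S: "finite S" "S \<noteq> {}" and "uniform_mat P S n r B"
  then have iid: "iid_mat P (distr (uniform_count_measure S) borel (\<lambda>x. x)) n r B"
    by (simp add: uniform_mat_def)
  have "measure P {\<omega> \<in> space P. mat_range (M * B \<omega>) = mat_range M} \<ge> 1 - real r * (1 / real (card S))"
    by (rule prob_mat_range_mult_eq_ge[OF assms(1,2) P iid prob_space_distr_uniform[OF S] _
          emeasure_distr_uniform_singleton_le[OF S]]) auto
  then show "measure P {\<omega> \<in> space P. mat_range (M * B \<omega>) = mat_range M} \<ge> 1 - real r / real (card S)"
    by simp
qed

end
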